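(* Let $\mathbb{P}_\infty \subset \mathbb{R}$ be the set of all odd integral multiples of $p$. The initial value problem $w' = 1 + w^2$, $w(0) = 0$ admits a unique holomorphic solution on $\mathbb{C} \setminus \mathbb{P}_\infty$; that is, there exists a unique holomorphic function $f : \mathbb{C} \setminus \mathbb{P}_\infty \to \mathbb{C}$ such that $f(0) = 0$ and $f'(z) = 1 + f(z)^2$ for all $z \in \mathbb{C} \setminus \mathbb{P}_\infty$.
   Context: Write $B_r(0)$ for the open disc of radius $r$ about $0$ in $\mathbb{C}$. There is a unique holomorphic function $h : B_{1/2}(0) \to \mathbb{C}$ with $h(0)=0$ and $h' = 1 + h^2$; it takes values in the open unit disc. It extends to a holomorphic function $h : B_1(0) \to \mathbb{C}$, given by $z \mapsto \frac{2h(z/2)}{1 - h(z/2)^2}$ in terms of the original $h$ on $B_{1/2}(0)$, which again satisfies $h(0)=0$ and $h'=1+h^2$. It is real-valued on $(-1,1)$. The real number $p$ is the unique $p \in (0,2)$ such that $h(\tfrac12 p) = 1$; equivalently $\tfrac12 p = \int_0^1 \frac{dt}{1+t^2}$. (The trigonometric and exponential functions are not assumed; $p$ is defined as just described.) *)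

theory Defs
  imports "HOL-Complex_Analysis.Complex_Analysis"
begin

text \<open>
  A function with domain \<open>S\<close> is modelled as a total function in \<open>extensional S\<close>, so that two of
  them are equal iff they agree on \<open>S\<close>. All domains used below are open, so \<open>deriv\<close> at a point
  of \<open>S\<close> does not depend on the values outside \<open>S\<close>.
\<close>

definition ivp_solution :: "complex set \<Rightarrow> (complex \<Rightarrow> complex) \<Rightarrow> bool" where
  "ivp_solution S f \<longleftrightarrow>
     f \<in> extensional S \<and> f holomorphic_on S \<and> f 0 = 0 \<and> (\<forall>z\<in>S. deriv f z = 1 + (f z)\<^sup>2)"

definition h_half :: "complex \<Rightarrow> complex" where
  "h_half = (THE f. ivp_solution (ball 0 (1/2)) f)"

text \<open>
  The extension of \<open>h_half\<close> to the unit disc. The denominator does not vanish there, because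
  \<open>h_half\<close> takes values in the open unit disc.
\<close>

definition h_unit :: "complex \<Rightarrow> complex" where
  "h_unit = (\<lambda>z\<in>ball 0 1. 2 * h_half (z/2) / (1 - (h_half (z/2))\<^sup>2))"

definition p_num :: real where
  "p_num = (THE x. 0 < x \<and> x < 2 \<and> h_unit (complex_of_real (x/2)) = 1)"

definition P_inf :: "real set" where
  "P_inf = {of_int k * p_num | k. odd k}"

end

theory Submission
  imports Defs
begin

text \<open>
  Every solution is the tangent: if \<open>f' = 1 + f\<^sup>2\<close>, then \<open>u = f \<cdot> cos - sin\<close> satisfies the linear
  equation \<open>u' = f \<cdot> u\<close> with \<open>u 0 = 0\<close>, so \<open>u\<close> vanishes near \<open>0\<close> and hence everywhere on a connected
  domain. Consequently \<open>p_num = pi / 2\<close>, and the excluded points are exactly the zeros of the cosine;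
  they are countable, so their complement is connected.
\<close>

text \<open>Integrating factor: on a disc \<open>f\<close> has a primitive \<open>F\<close>, and
  \<open>u z * exp (- F z)\<close> has derivative zero. It is therefore constant, with the value
  zero it takes at the centre.\<close>

lemma linear_ode_zero_on_ball:
  fixes u f :: "complex \<Rightarrow> complex"
  assumes f: "f holomorphic_on ball a r"
    and u: "\<And>z. z \<in> ball a r \<Longrightarrow> (u has_field_derivative f z * u z) (at z)"
    and "u a = 0" and z: "z \<in> ball a r"
  shows "u z = 0"
proof -
  obtain F where "\<And>z. z \<in> ball a r \<Longrightarrow> (F has_field_derivative f z) (at z within ball a r)"
    using holomorphic_convex_primitive'[OF convex_ball open_ball f] by blast
  then have F: "(F has_field_derivative f z) (at z)" if "z \<in> ball a r" for z
    using that by (metis at_within_open open_ball)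
  have "((\<lambda>z. u z * exp (- F z)) has_field_derivative 0) (at z within ball a r)"
    if "z \<in> ball a r" for z
  proof -
    have "((\<lambda>z. u z * exp (- F z)) has_field_derivative 0) (at z)"
      using that by (auto intro!: derivative_eq_intros u F simp: algebra_simps)
    then show ?thesis
      by (rule has_field_derivative_at_within)
  qed
  from has_field_derivative_zero_constant[OF convex_ball this]
  obtain c where c: "\<And>z. z \<in> ball a r \<Longrightarrow> u z * exp (- F z) = c"
    by blast
  \<comment> \<open>The radius is positive because the ball contains \<open>z\<close>.\<close>
  have "a \<in> ball a r"
    using z zero_le_dist[of a z] by (simp del: zero_le_dist)
  then show ?thesis
    using c[of a] c[OF z] \<open>u a = 0\<close> by simp
qed

lemma ivp_solution_eq_tan:
  assumes "open S" "connected S" "0 \<in> S" and f: "ivp_solution S f" and z: "z \<in> S"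
  shows "cos z \<noteq> 0 \<and> f z = tan z"
proof -
  have hol: "f holomorphic_on S" and f0: "f 0 = 0"
    and der: "\<And>z. z \<in> S \<Longrightarrow> deriv f z = 1 + (f z)\<^sup>2"
    using f by (auto simp: ivp_solution_def)
  have fder: "(f has_field_derivative 1 + (f z)\<^sup>2) (at z)" if "z \<in> S" for z
    using holomorphic_derivI[OF hol \<open>open S\<close> that, of UNIV] der[OF that] by simp
  define u where "u z = f z * cos z - sin z" for z
  have u: "(u has_field_derivative f z * u z) (at z)" if "z \<in> S" for z
    unfolding u_def
    by (auto intro!: derivative_eq_intros fder that simp: algebra_simps power2_eq_square)
  obtain r where "r > 0" and r: "ball 0 r \<subseteq> S"
    using \<open>open S\<close> \<open>0 \<in> S\<close> by (meson open_contains_ball)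
  have "u w = 0" if "w \<in> ball 0 r" for w
  proof (rule linear_ode_zero_on_ball[where u = u and z = w])
    show "f holomorphic_on ball 0 r"
      using hol r holomorphic_on_subset by blast
    show "u 0 = 0" 
      by (simp add: u_def f0)
  qed (use u r that in auto)
  \<comment> \<open>\<open>S\<close> may have holes, so \<open>f\<close> may lack a primitive on it;
    the identity theorem carries the vanishing of \<open>u\<close> from the disc to all of
    \<open>S\<close>.\<close>
  moreover have "u holomorphic_on S"
    unfolding u_def by (intro holomorphic_intros hol)
  ultimately have "u z = 0"
    using analytic_continuation_open[of "ball 0 r" S u "\<lambda>_. 0" z] \<open>open S\<close> \<open>connected S\<close> \<open>r > 0\<close> r z
    by auto
  then have eq: "f z * cos z = sin z"
    by (simp add: u_def)
  \<comment> \<open>A zero of the cosine would by \<open>eq\<close> also be a zero of the sine,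
    against \<open>sin z ^ 2 + cos z ^ 2 = 1\<close>.\<close>
  have "cos z \<noteq> 0"
    using eq sin_cos_squared_add[of z] by (metis mult_zero_right power_zero_numeral add_0 zero_neq_one)
  then show ?thesis
    using eq by (simp add: tan_def field_simps)
qed

lemma ivp_solution_tan:
  assumes "open S" "0 \<in> S" and nz: "\<And>z. z \<in> S \<Longrightarrow> cos z \<noteq> 0"
  shows "ivp_solution S (restrict tan S)"
proof -
  have der: "(restrict tan S has_field_derivative 1 + (tan z)\<^sup>2) (at z)" if "z \<in> S" for z
  proof (rule has_field_derivative_transform_within_open[OF _ \<open>open S\<close> that])
    show "(tan has_field_derivative 1 + (tan z)\<^sup>2) (at z)"
      using DERIV_tan[OF nz[OF that]] tan_sec[OF nz[OF that]] by (simp add: power_inverse)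
  qed simp
  have "restrict tan S holomorphic_on S"
    using der \<open>open S\<close> holomorphic_on_open by blast
  then show ?thesis
    using der \<open>0 \<in> S\<close> by (auto simp: ivp_solution_def DERIV_imp_deriv)
qed

text \<open>Existence and uniqueness in one equivalence, serving both the disc that defines
  \<open>h_half\<close> and the plane without the poles. Membership in \<open>extensional S\<close>
  turns agreement on \<open>S\<close> into equality.\<close>

lemma ivp_solution_iff:
  assumes "open S" "connected S" "0 \<in> S" and "\<And>z. z \<in> S \<Longrightarrow> cos z \<noteq> 0"
  shows "ivp_solution S f \<longleftrightarrow> f = restrict tan S"
proof
  assume f: "ivp_solution S f"
  then have "f \<in> extensional S"
    by (simp add: ivp_solution_def)
  then show "f = restrict tan S"
    by (rule extensionalityI) (simp_all add: ivp_solution_eq_tan[OF assms(1-3) f])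
next
  assume "f = restrict tan S"
  then show "ivp_solution S f"
    using ivp_solution_tan[OF assms(1,3,4)] by blast
qed

text \<open>Rewrites the zeros \<open>n * pi + pi / 2\<close> as odd multiples of
  \<open>pi / 2\<close>, the shape of \<open>P_inf\<close> once \<open>p_num\<close> is
  known.\<close>

lemma cos_eq_0_iff_odd:
  fixes z :: complex
  shows "cos z = 0 \<longleftrightarrow> (\<exists>k. odd k \<and> z = of_real (of_int k * (pi / 2)))"
proof -
  have eq: "complex_of_real (of_int n * pi) + of_real pi / 2 = of_real (of_int (2 * n + 1) * (pi / 2))" for n
    by (simp add: field_simps)
  show ?thesis
  proof
    assume "cos z = 0"
    then obtain n where "z = of_real (of_int (2 * n + 1) * (pi / 2))"
      by (simp only: cos_eq_0 eq) (erule exE)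
    moreover have "odd (2 * n + 1)"
      by simp
    ultimately show "\<exists>k. odd k \<and> z = of_real (of_int k * (pi / 2))"
      by (intro exI[of _ "2 * n + 1"] conjI)
  next
    assume "\<exists>k. odd k \<and> z = of_real (of_int k * (pi / 2))"
    then obtain k where k: "odd k" and z: "z = of_real (of_int k * (pi / 2))"
      by (elim exE conjE)
    obtain n where "k = 2 * n + 1"
      using k by (rule oddE)
    then show "cos z = 0"
      by (simp only: cos_eq_0 eq z) (rule exI[of _ n], rule refl)
  qed
qed

text \<open>An odd integer has absolute value at least 1, so no zero of the cosine is closer to the
  origin than \<open>pi / 2\<close>.\<close>

lemma cos_nonzero_of_norm_less:
  fixes z :: complex
  assumes "norm z < pi / 2"
  shows "cos z \<noteq> 0"
proof
  assume "cos z = 0"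
  then obtain k where "odd k" and z: "z = of_real (of_int k * (pi / 2))"
    by (auto simp: cos_eq_0_iff_odd)
  have "1 \<le> \<bar>k\<bar>"
    using \<open>odd k\<close> by presburger
  then have "1 * (pi / 2) \<le> \<bar>of_int k\<bar> * (pi / 2)"
    by (intro mult_right_mono) auto
  then show False
    using assms by (simp add: z abs_mult del: of_real_mult)
qed

lemma h_half_eq: "h_half = restrict tan (ball 0 (1/2))"
proof -
  have "cos z \<noteq> 0" if "z \<in> ball 0 (1/2)" for z :: complex
    using that pi_gt3 by (intro cos_nonzero_of_norm_less) auto
  then have "ivp_solution (ball 0 (1/2)) f \<longleftrightarrow> f = restrict tan (ball 0 (1/2))" for f
    by (intro ivp_solution_iff) auto
  then show ?thesis
    by (simp add: h_half_def)
qed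

text \<open>The defining expression is the double-angle formula for the tangent. It needs a nonzero
  cosine at \<open>z/2\<close> and at \<open>z\<close>, and both have norm below
  \<open>1 < pi / 2\<close>.\<close>

lemma h_unit_eq:
  assumes "norm z < 1"
  shows "h_unit z = tan z"
proof -
  have "cos (z/2) \<noteq> 0" "cos (2 * (z/2)) \<noteq> 0"
    using assms pi_gt3 by (auto intro!: cos_nonzero_of_norm_less simp: norm_divide)
  from tan_double[OF this] show ?thesis
    using assms by (simp add: h_unit_def h_half_eq norm_divide)
qed

lemma p_num_eq: "p_num = pi / 2"
  unfolding p_num_def
proof (rule the_equality)
  show "0 < pi / 2 \<and> pi / 2 < 2 \<and> h_unit (complex_of_real (pi / 2 / 2)) = 1"
    using pi_less_4 h_unit_eq[of "complex_of_real (pi / 4)"]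
    by (simp add: tan_of_real[symmetric] tan_45 del: of_real_divide)
next
  fix x :: real
  assume x: "0 < x \<and> x < 2 \<and> h_unit (complex_of_real (x/2)) = 1"
  then have "complex_of_real (tan (x/2)) = 1"
    using h_unit_eq[of "complex_of_real (x/2)"]
    by (simp add: tan_of_real[symmetric] del: of_real_divide)
  then have "tan (x/2) = 1"
    using of_real_eq_1_iff by blast
  \<comment> \<open>The bounds on \<open>x\<close> put \<open>x/2\<close> in the interval from 0 to
    1, inside the principal branch of the tangent.\<close>
  then have "arctan 1 = x/2"
    using x pi_gt3 by (intro arctan_unique) auto
  then show "x = pi / 2"
    by simp
qed

lemma P_inf_eq: "complex_of_real ` P_inf = {z. cos z = 0}"
proof -
  have "complex_of_real ` P_inf = {of_real (of_int k * (pi / 2)) | k. odd k}"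
    unfolding P_inf_def p_num_eq by (simp only: setcompr_eq_image image_image)
  also have "\<dots> = {z. cos z = 0}"
    by (simp only: cos_eq_0_iff_odd conj_commute)
  finally show ?thesis .
qed

theorem theorem7:
  shows "\<exists>!f. ivp_solution (UNIV - complex_of_real ` P_inf) f"
proof -
  let ?S = "UNIV - complex_of_real ` P_inf"
  have S: "?S = {z. cos z \<noteq> 0}"
    by (auto simp: P_inf_eq)
  have "countable (complex_of_real ` P_inf)"
    unfolding P_inf_def setcompr_eq_image by (intro countable_image countableI_type)
  then have "connected ?S"
    by (intro connected_open_diff_countable) (simp_all add: connected_UNIV)
  \<comment> \<open>Openness is read off from the nonvanishing of a continuous function, while
    countability came from the indexing by integers.\<close>
  moreover have "open ?S"
    unfolding S by (intro open_Collect_neq continuous_intros)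
  moreover have "0 \<in> ?S" "\<And>z. z \<in> ?S \<Longrightarrow> cos z \<noteq> 0"
    unfolding S by simp_all
  ultimately have "ivp_solution ?S f \<longleftrightarrow> f = restrict tan ?S" for f
    by (intro ivp_solution_iff)
  then show ?thesis
    by simp
qed

end
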